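(* There is a universal constant $C_0>0$ such that the following holds. Let $n\ge1$, let $A:B$ be a bipartition of $\{1,\dots,n\}$, let $\mathcal Q$ be an orthogonal operator basis for $n$ qubits, and let $\epsilon\in(0,1)$, $\delta\in(0,1/2]$. Then there is a quantum algorithm which, for every Hermitian operator $O$ on $n$ qubits with $\mathrm{tr}(O^2)=2^n$ and every $n$-qubit unitary $U$, with $O(t)=U^\dagger OU$, estimates the linearized local operator entanglement $E^2_{\mathrm{lin},A}(O(t))=1-\mathrm{tr}(\rho_A^2)$ to additive error $\epsilon$ with success probability at least $1-\delta$, using at most $C_0\log(1/\delta)/\epsilon^2$ copies of the state $|O(t)\rangle\rangle_{\mathcal Q}$.
   Context: An orthogonal operator basis is a basis $\mathcal Q=\{Q_k\}_{k=1}^{4^n}$ of the operators on $(\mathbb C^2)^{\otimes n}$ with $\mathrm{tr}(Q_k^\dagger Q_l)=N\delta_{kl}$ for some $N>0$. The doubled $2n$-qubit Hilbert space is $\mathcal H'=\bigotimes_{i=1}^n(\mathcal H_L^i\otimes\mathcal H_R^i)$ with each $\mathcal H_L^i,\mathcal H_R^i\cong\mathbb C^2$, and its computational basis is labelled $\{|k\rangle\}_{k=1}^{4^n}$. The vectorization of an operator $X\ne0$ in $\mathcal Q$ is the unit vector $|X\rangle\rangle_{\mathcal Q}=\sum_k \frac{c_k}{\sqrt{\sum_i|c_i|^2}}|k\rangle\in\mathcal H'$, where $c_k=\mathrm{tr}(Q_k^\dagger X)/N$. For the operator $X=O(t)$, the reduced density matrix is $\rho_A=\mathrm{tr}_B\left(|X\rangle\rangle_{\mathcal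 Q}\,{}_{\mathcal Q}\langle\langle X|\right)$, obtained by tracing out $\bigotimes_{i\in B}(\mathcal H_L^i\otimes\mathcal H_R^i)$. A "quantum algorithm using $m$ copies" is a quantum measurement on $m$ copies of the state (joint measurements on several copies allowed), followed by classical post-processing giving a real number; it does not depend on $O$ or $U$ except through the copies of the state. *)

theory Defs
  imports Complex_Main "Jordan_Normal_Form.Schur_Decomposition"
begin

text \<open>Operators on \<open>n\<close> qubits are complex \<open>2^n \<times> 2^n\<close> matrices. Since \<open>n\<close> is quantified inside
  the theorem, dimensions are handled through carriers. All indices into vectors, matrices
  and operator bases start at \<open>0\<close>; the qubits (sites) themselves are numbered \<open>1, \<dots>, n\<close>.\<close>

definition mat_trace :: "complex mat \<Rightarrow> complex" where
  "mat_trace M = (\<Sum>i<dim_row M. M $$ (i, i))"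

definition hermitian_op :: "nat \<Rightarrow> complex mat \<Rightarrow> bool" where
  "hermitian_op d X \<longleftrightarrow> X \<in> carrier_mat d d \<and> mat_adjoint X = X"

definition unitary_op :: "nat \<Rightarrow> complex mat \<Rightarrow> bool" where
  "unitary_op d U \<longleftrightarrow> U \<in> carrier_mat d d \<and>
     mat_adjoint U * U = 1\<^sub>m d \<and> U * mat_adjoint U = 1\<^sub>m d"

definition heisenberg :: "complex mat \<Rightarrow> complex mat \<Rightarrow> complex mat" where
  "heisenberg U X = mat_adjoint U * X * U"


text \<open>Only the values \<open>Q k\<close> with \<open>k < 4^n\<close> matter. The expansion clause says that they form a
  basis (existence and uniqueness of coefficients); it is in fact implied by orthogonality.\<close>

definition orthogonal_operator_basis :: "nat \<Rightarrow> real \<Rightarrow> (nat \<Rightarrow> complex mat) \<Rightarrow> bool" where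
  "orthogonal_operator_basis n N Q \<longleftrightarrow>
     N > 0 \<and>
     (\<forall>k<4^n. Q k \<in> carrier_mat (2^n) (2^n)) \<and>
     (\<forall>X\<in>carrier_mat (2^n) (2^n). \<exists>!c. c \<in> carrier_vec (4^n) \<and>
        X = mat (2^n) (2^n) (\<lambda>(i, j). \<Sum>k<4^n. c $ k * Q k $$ (i, j))) \<and>
     (\<forall>k<4^n. \<forall>l<4^n.
        mat_trace (mat_adjoint (Q k) * Q l) = (if k = l then complex_of_real N else 0))"

definition op_coeff :: "real \<Rightarrow> (nat \<Rightarrow> complex mat) \<Rightarrow> complex mat \<Rightarrow> nat \<Rightarrow> complex" where
  "op_coeff N Q X k = mat_trace (mat_adjoint (Q k) * X) / complex_of_real N"

definition vectorization ::
    "nat \<Rightarrow> real \<Rightarrow> (nat \<Rightarrow> complex mat) \<Rightarrow> complex mat \<Rightarrow> complex vec" where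
  "vectorization n N Q X = vec (4^n) (\<lambda>k. op_coeff N Q X k /
     complex_of_real (sqrt (\<Sum>i<4^n. (cmod (op_coeff N Q X i))\<^sup>2)))"


text \<open>The computational basis of the doubled space is labelled lexicographically: \<open>k < 4^n\<close>
  is read as an \<open>n\<close>-digit base-4 number, site \<open>1\<close> being the most significant digit. The digit
  \<open>2 l + r\<close> at site \<open>i\<close> stands for the basis vector \<open>|l\<rangle> \<otimes> |r\<rangle>\<close> of \<open>H\<^sub>L \<otimes> H\<^sub>R\<close> at that site.
  (Another labelling amounts to reordering the operator basis.) For a set \<open>S\<close> of sites,
  \<open>sub_index n S k\<close> is the label, below \<open>4^card S\<close>, of the part of \<open>k\<close> on \<open>S\<close>.\<close>

definition site_digit :: "nat \<Rightarrow> nat \<Rightarrow> nat \<Rightarrow> nat" where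
  "site_digit n k i = (k div 4^(n - i)) mod 4"

definition sub_index :: "nat \<Rightarrow> nat set \<Rightarrow> nat \<Rightarrow> nat" where
  "sub_index n S k = (\<Sum>i\<in>S. site_digit n k i * 4 ^ card {j\<in>S. i < j})"

definition bipartition :: "nat \<Rightarrow> nat set \<Rightarrow> nat set \<Rightarrow> bool" where
  "bipartition n A B \<longleftrightarrow> A \<union> B = {1..n} \<and> A \<inter> B = {}"

text \<open>The entry \<open>\<langle>a| tr\<^sub>B M |a'\<rangle>\<close> is \<open>\<Sum>\<^sub>b \<langle>a,b| M |a',b\<rangle>\<close>; in the sum below \<open>k\<close> and \<open>l\<close>
  are the labels of \<open>(a,b)\<close> and \<open>(a',b)\<close>.\<close>

definition partial_trace :: "nat \<Rightarrow> nat set \<Rightarrow> nat set \<Rightarrow> complex mat \<Rightarrow> complex mat" where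
  "partial_trace n A B M = mat (4 ^ card A) (4 ^ card A) (\<lambda>(a, a').
     \<Sum>(k, l) \<in> {(k, l). k < 4^n \<and> l < 4^n \<and> sub_index n A k = a \<and> sub_index n A l = a' \<and>
                  sub_index n B k = sub_index n B l}. M $$ (k, l))"

definition pure_density :: "complex vec \<Rightarrow> complex mat" where
  "pure_density v = mat (dim_vec v) (dim_vec v) (\<lambda>(i, j). v $ i * conjugate (v $ j))"

definition reduced_density ::
    "nat \<Rightarrow> nat set \<Rightarrow> nat set \<Rightarrow> real \<Rightarrow> (nat \<Rightarrow> complex mat) \<Rightarrow> complex mat \<Rightarrow> complex mat" where
  "reduced_density n A B N Q X = partial_trace n A B (pure_density (vectorization n N Q X))"

text \<open>The trace is real because a reduced density matrix is Hermitian.\<close>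

definition lin_op_entanglement ::
    "nat \<Rightarrow> nat set \<Rightarrow> nat set \<Rightarrow> real \<Rightarrow> (nat \<Rightarrow> complex mat) \<Rightarrow> complex mat \<Rightarrow> real" where
  "lin_op_entanglement n A B N Q X =
     1 - Re (mat_trace (reduced_density n A B N Q X * reduced_density n A B N Q X))"


definition tensor_vec :: "complex vec \<Rightarrow> complex vec \<Rightarrow> complex vec" where
  "tensor_vec u v = vec (dim_vec u * dim_vec v) (\<lambda>i. u $ (i div dim_vec v) * v $ (i mod dim_vec v))"

primrec copies :: "nat \<Rightarrow> complex vec \<Rightarrow> complex vec" where
  "copies 0 v = vec 1 (\<lambda>_. 1)"
| "copies (Suc m) v = tensor_vec v (copies m v)"

text \<open>In the order on \<^typ>\<open>complex\<close>, \<open>0 \<le> z\<close> means that \<open>z\<close> is real and nonnegative.\<close>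

definition psd_op :: "nat \<Rightarrow> complex mat \<Rightarrow> bool" where
  "psd_op d E \<longleftrightarrow> E \<in> carrier_mat d d \<and> (\<forall>v\<in>carrier_vec d. 0 \<le> (E *\<^sub>v v) \<bullet>c v)"

text \<open>A quantum measurement with outcomes \<open>0, \<dots>, K - 1\<close> on a \<open>d\<close>-dimensional system, given
  by its effects \<open>E 0, \<dots>, E (K - 1)\<close>.\<close>

definition povm :: "nat \<Rightarrow> nat \<Rightarrow> (nat \<Rightarrow> complex mat) \<Rightarrow> bool" where
  "povm d K E \<longleftrightarrow> (\<forall>j<K. psd_op d (E j)) \<and>
     mat d d (\<lambda>(a, b). \<Sum>j<K. E j $$ (a, b)) = 1\<^sub>m d"

definition outcome_prob :: "(nat \<Rightarrow> complex mat) \<Rightarrow> complex vec \<Rightarrow> nat \<Rightarrow> real" where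
  "outcome_prob E v j = Re ((E j *\<^sub>v v) \<bullet>c v)"

text \<open>The probability that the post-processed outcome \<open>f j\<close> is within \<open>\<epsilon>\<close> of the value \<open>t\<close>.\<close>

definition success_prob ::
    "nat \<Rightarrow> (nat \<Rightarrow> complex mat) \<Rightarrow> (nat \<Rightarrow> real) \<Rightarrow> complex vec \<Rightarrow> real \<Rightarrow> real \<Rightarrow> real" where
  "success_prob K E f v t \<epsilon> = (\<Sum>j\<in>{j. j < K \<and> \<bar>f j - t\<bar> \<le> \<epsilon>}. outcome_prob E v j)"

end

theory Submission
  imports Defs
begin

text \<open>The purity \<open>tr (\<rho>\<^sub>A\<^sup>2)\<close> is the expectation on two copies of the pure state of the unitary that
  swaps the \<open>A\<close> parts of the copies. This unitary is an involution, so measuring it gives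
  \<open>1\<close> or \<open>-1\<close> with mean \<open>tr (\<rho>\<^sub>A\<^sup>2)\<close>. Measuring \<open>M\<close> disjoint pairs of copies gives independent
  outcomes, and by a Chernoff bound their average deviates from the mean by more than \<open>\<epsilon>\<close> with
  probability at most \<open>2 exp (- M \<epsilon>\<^sup>2 / 4)\<close>. Hence \<open>M \<approx> 4 ln (2 / \<delta>) / \<epsilon>\<^sup>2\<close> pairs suffice.\<close>

section \<open>Sums over composite indices\<close>

lemma nat_add_mult_less:
  fixes i j a b :: nat
  assumes "i < a" "j < b"
  shows "i * b + j < a * b"
proof -
  have "i * b + j < Suc i * b" using assms by simp
  also have "\<dots> \<le> a * b" using assms by (intro mult_right_mono) auto
  finally show ?thesis .
qed

text \<open>A basis label of a tensor product encodes a pair of labels as quotient and remainder.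
  This lets sums over such labels factor in all the tensor product computations below.\<close>

lemma sum_div_mod:
  fixes f :: "nat \<Rightarrow> nat \<Rightarrow> 'a::comm_monoid_add"
  shows "(\<Sum>x<a * b. f (x div b) (x mod b)) = (\<Sum>i<a. \<Sum>j<b. f i j)"
proof (cases "b = 0")
  case False
  then have "(\<Sum>x<a * b. f (x div b) (x mod b)) = (\<Sum>(i, j)\<in>{..<a} \<times> {..<b}. f i j)"
    by (intro sum.reindex_bij_witness[where i = "\<lambda>(i, j). i * b + j" and j = "\<lambda>x. (x div b, x mod b)"])
      (auto simp: less_mult_imp_div_less nat_add_mult_less)
  then show ?thesis by (simp add: sum.cartesian_product)
qed simp

text \<open>Splits off the least significant binary digit, which records the first of
  \<open>Suc M\<close> outcomes. The inductions over the number of measurements that sum over all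
  outcomes rest on it.\<close>

lemma sum_pow2_Suc:
  fixes f :: "nat \<Rightarrow> nat \<Rightarrow> 'a::comm_monoid_add"
  shows "(\<Sum>j<2 ^ Suc M. f (j mod 2) (j div 2)) = (\<Sum>i<2 ^ M. f 0 i + f 1 i)"
proof -
  have "{..<2::nat} = {0, 1}" by auto
  then show ?thesis
    using sum_div_mod[where f = "\<lambda>x y. f y x" and a = "2 ^ M" and b = 2] by (simp add: mult.commute[of 2])
qed

section \<open>A Chernoff bound\<close>

text \<open>For negative \<open>y\<close> put \<open>z = - y\<close>. The Taylor lower bound for
  \<open>exp z\<close>, multiplied by \<open>1 - z + z^2\<close>, gives
  \<open>1 + (z^2 + z^3 + z^4) / 2\<close>, which is at least 1. Dividing by \<open>exp z\<close>
  yields the claim.\<close>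

lemma exp_le_quadratic:
  fixes y :: real
  assumes "\<bar>y\<bar> \<le> 1"
  shows "exp y \<le> 1 + y + y\<^sup>2"
proof (cases "0 \<le> y")
  case True
  then show ?thesis using exp_bound assms by simp
next
  case False
  define z where "z = - y"
  have z: "0 \<le> z" "z \<le> 1" using False assms by (auto simp: z_def)
  have "1 + z + z\<^sup>2 / 2 \<le> exp z" using z by (intro exp_lower_Taylor_quadratic) simp
  moreover have "0 \<le> 1 - z + z\<^sup>2" using z by simp
  ultimately have "(1 + z + z\<^sup>2 / 2) * (1 - z + z\<^sup>2) \<le> exp z * (1 - z + z\<^sup>2)"
    by (rule mult_right_mono)
  moreover have "(1 + z + z\<^sup>2 / 2) * (1 - z + z\<^sup>2) = 1 + (z\<^sup>2 + z ^ 3 + z ^ 4) / 2"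
    by (simp add: field_simps power2_eq_square power3_eq_cube power4_eq_xxxx)
  moreover have "0 \<le> z\<^sup>2 + z ^ 3 + z ^ 4" using z by simp
  ultimately have "1 \<le> exp z * (1 - z + z\<^sup>2)"
    by (metis add_increasing2 divide_nonneg_nonneg order.refl order.trans zero_le_numeral)
  then have "exp (- z) * 1 \<le> exp (- z) * (exp z * (1 - z + z\<^sup>2))" by (intro mult_left_mono) auto
  then have "exp (- z) \<le> 1 - z + z\<^sup>2" by (simp add: mult.assoc[symmetric] exp_minus)
  then show ?thesis by (simp add: z_def)
qed

text \<open>The outcomes of \<open>M\<close> two-valued measurements are the binary digits of a number \<open>j < 2^M\<close>,
  that of the first measurement being the least significant. Digit \<open>0\<close> scores \<open>1\<close>, digit \<open>1\<close>
  scores \<open>-1\<close>.\<close>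

primrec seq_weight :: "(nat \<Rightarrow> real) \<Rightarrow> nat \<Rightarrow> nat \<Rightarrow> real" where
  "seq_weight q 0 j = 1"
| "seq_weight q (Suc M) j = q (j mod 2) * seq_weight q M (j div 2)"

primrec score :: "nat \<Rightarrow> nat \<Rightarrow> real" where
  "score 0 j = 0"
| "score (Suc M) j = (if j mod 2 = 0 then 1 else - 1) + score M (j div 2)"

lemma seq_weight_nonneg:
  assumes "0 \<le> q 0" "0 \<le> q 1"
  shows "0 \<le> seq_weight q M j"
proof (induction M arbitrary: j)
  case (Suc M)
  have "j mod 2 = 0 \<or> j mod 2 = 1" by auto
  then show ?case using Suc assms by auto
qed simp

lemma sum_seq_weight:
  assumes "q 0 + q 1 = 1"
  shows "(\<Sum>j<2 ^ M. seq_weight q M j) = 1"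
proof (induction M)
  case (Suc M)
  have "(\<Sum>j<2 ^ Suc M. seq_weight q (Suc M) j) = (\<Sum>i<2 ^ M. q 0 * seq_weight q M i + q 1 * seq_weight q M i)"
    using sum_pow2_Suc[of "\<lambda>b i. q b * seq_weight q M i" M] by simp
  also have "\<dots> = (\<Sum>i<2 ^ M. seq_weight q M i)"
    using assms by (simp add: distrib_right[symmetric])
  finally show ?case using Suc by simp
qed simp

text \<open>This is the exponential moment of the centred score. By independence it is a product of
  \<open>M\<close> equal factors, and each of them is at most \<open>exp (s^2)\<close>.\<close>

lemma seq_weight_moment:
  assumes q: "0 \<le> q 0" "0 \<le> q 1" "q 0 + q 1 = 1" and P: "P = q 0 - q 1" and s: "\<bar>s\<bar> \<le> 1 / 2"
  shows "(\<Sum>j<2 ^ M. seq_weight q M j * exp (s * (score M j - M * P))) \<le> exp (M * s\<^sup>2)"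
proof (induction M)
  case (Suc M)
  define G where "G i = seq_weight q M i * exp (s * (score M i - M * P))" for i
  define c where "c = q 0 * exp (s * (1 - P)) + q 1 * exp (s * (- 1 - P))"
  have q01: "q 0 = (1 + P) / 2" "q 1 = (1 - P) / 2" using q P by auto
  have P1: "\<bar>P\<bar> \<le> 1" using q P by auto
  have le: "\<bar>s * y\<bar> \<le> 1" if "\<bar>y\<bar> \<le> 2" for y
    using mult_mono[OF s that] by (simp add: abs_mult)
  \<comment> \<open>\<open>c\<close> is the moment of a single centred outcome. The bound on
    \<open>s\<close> keeps both exponents within [-1, 1]. The linear terms cancel because
    \<open>P\<close> is the mean, and the quadratic terms leave the variance
    \<open>1 - P^2\<close>.\<close>
  have "c \<le> q 0 * (1 + s * (1 - P) + (s * (1 - P))\<^sup>2) + q 1 * (1 + s * (- 1 - P) + (s * (- 1 - P))\<^sup>2)"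
    unfolding c_def using P1 q by (intro add_mono mult_left_mono exp_le_quadratic le) auto
  also have "\<dots> = 1 + s\<^sup>2 * (1 - P\<^sup>2)"
    unfolding q01 by (simp add: field_simps power2_eq_square)
  also have "\<dots> \<le> 1 + s\<^sup>2" by (simp add: mult_left_le)
  also have "\<dots> \<le> exp (s\<^sup>2)" by simp
  finally have c: "c \<le> exp (s\<^sup>2)" .
  have "(\<Sum>j<2 ^ Suc M. seq_weight q (Suc M) j * exp (s * (score (Suc M) j - Suc M * P)))
    = (\<Sum>j<2 ^ Suc M. (\<lambda>b i. q b * exp (s * ((if b = 0 then 1 else - 1) - P)) * G i) (j mod 2) (j div 2))"
    by (intro sum.cong refl) (simp add: G_def exp_add[symmetric] algebra_simps)
  also have "\<dots> = (\<Sum>i<2 ^ M. c * G i)"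
    by (subst sum_pow2_Suc) (simp add: c_def distrib_right)
  also have "\<dots> = c * (\<Sum>i<2 ^ M. G i)" by (simp add: sum_distrib_left)
  also have "\<dots> \<le> exp (s\<^sup>2) * exp (M * s\<^sup>2)"
    using Suc seq_weight_nonneg[of q M] q unfolding G_def
    by (intro mult_mono c sum_nonneg) auto
  finally show ?case by (simp add: exp_add[symmetric] algebra_simps)
qed simp

text \<open>An exponential Markov inequality. On the bad event the sum of
  \<open>exp (s * Y j)\<close> and \<open>exp (- s * Y j)\<close> is at least
  \<open>exp (s * M * \<epsilon>)\<close>, so the moments at \<open>s\<close> and \<open>- s\<close>
  together control both tails.\<close>

lemma seq_weight_tail:
  assumes q: "0 \<le> q 0" "0 \<le> q 1" "q 0 + q 1 = 1" and P: "P = q 0 - q 1" and e: "0 < \<epsilon>" "\<epsilon> \<le> 1"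
  shows "(\<Sum>j | j < 2 ^ M \<and> M * \<epsilon> < \<bar>score M j - M * P\<bar>. seq_weight q M j) \<le> 2 * exp (- (M * \<epsilon>\<^sup>2 / 4))"
proof -
  \<comment> \<open>This value minimizes the exponent \<open>M * s^2 - s * M * \<epsilon>\<close>,
    with minimum \<open>- M * \<epsilon>^2 / 4\<close>. Since \<epsilon> is at most 1, it satisfies
    the bound on \<open>s\<close> in the moment estimate.\<close>
  define s where "s = \<epsilon> / 2"
  define Y where "Y j = score M j - M * P" for j
  let ?w = "seq_weight q M"
  have w: "0 \<le> ?w j" for j using q by (simp add: seq_weight_nonneg)
  have "(\<Sum>j | j < 2 ^ M \<and> M * \<epsilon> < \<bar>Y j\<bar>. ?w j)
    \<le> (\<Sum>j | j < 2 ^ M \<and> M * \<epsilon> < \<bar>Y j\<bar>. ?w j * ((exp (s * Y j) + exp (- s * Y j)) * exp (- s * (M * \<epsilon>))))"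
  proof (intro sum_mono)
    fix j assume "j \<in> {j. j < 2 ^ M \<and> M * \<epsilon> < \<bar>Y j\<bar>}"
    then have "0 \<le> s * (\<bar>Y j\<bar> - M * \<epsilon>)" using e by (simp add: s_def)
    then have "1 \<le> exp (s * \<bar>Y j\<bar>) * exp (- s * (M * \<epsilon>))"
      by (simp add: exp_add[symmetric] algebra_simps)
    also have "\<dots> \<le> (exp (s * Y j) + exp (- s * Y j)) * exp (- s * (M * \<epsilon>))"
      by (intro mult_right_mono) (auto simp: abs_if)
    finally have "1 \<le> (exp (s * Y j) + exp (- s * Y j)) * exp (- s * (M * \<epsilon>))" .
    from mult_left_mono[OF this w[of j]]
    show "?w j \<le> ?w j * ((exp (s * Y j) + exp (- s * Y j)) * exp (- s * (M * \<epsilon>)))" by simp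
  qed
  also have "\<dots> \<le> (\<Sum>j<2 ^ M. ?w j * ((exp (s * Y j) + exp (- s * Y j)) * exp (- s * (M * \<epsilon>))))"
    by (intro sum_mono2) (auto simp: w add_nonneg_nonneg)
  also have "\<dots> = ((\<Sum>j<2 ^ M. ?w j * exp (s * Y j)) + (\<Sum>j<2 ^ M. ?w j * exp (- s * Y j))) * exp (- s * (M * \<epsilon>))"
    unfolding sum.distrib[symmetric] sum_distrib_right by (intro sum.cong refl) (simp add: algebra_simps)
  also have "\<dots> \<le> (exp (M * s\<^sup>2) + exp (M * (- s)\<^sup>2)) * exp (- s * (M * \<epsilon>))"
    unfolding Y_def using e
    by (intro mult_right_mono add_mono seq_weight_moment q P) (auto simp: s_def)
  also have "\<dots> = 2 * (exp (M * s\<^sup>2) * exp (- s * (M * \<epsilon>)))" by simp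
  also have "\<dots> = 2 * exp (- (M * \<epsilon>\<^sup>2 / 4))"
    unfolding exp_add[symmetric] by (simp add: s_def power2_eq_square field_simps)
  finally show ?thesis unfolding Y_def .
qed

section \<open>Projectors and tensor products\<close>

lemma mat_adjoint_carrier [simp]:
  "A \<in> carrier_mat r c \<Longrightarrow> mat_adjoint A \<in> carrier_mat c r"
  by (auto simp: mat_adjoint_def mat_of_rows_def)

lemma mat_adjoint_index [simp]:
  assumes "i < dim_col A" "j < dim_row A"
  shows "mat_adjoint A $$ (i, j) = conjugate (A $$ (j, i))"
  using assms by (simp add: mat_adjoint_def mat_of_rows_index)

lemma hermitian_op_iff:
  "hermitian_op d P \<longleftrightarrow> P \<in> carrier_mat d d \<and> (\<forall>i<d. \<forall>j<d. cnj (P $$ (j, i)) = P $$ (i, j))"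
proof -
  have "mat_adjoint P = P \<longleftrightarrow> (\<forall>i<d. \<forall>j<d. cnj (P $$ (j, i)) = P $$ (i, j))"
    if P: "P \<in> carrier_mat d d"
    using P carrier_matD[OF mat_adjoint_carrier[OF P]] by (auto simp: mat_eq_iff)
  then show ?thesis by (auto simp: hermitian_op_def)
qed

definition projector :: "nat \<Rightarrow> complex mat \<Rightarrow> bool" where
  "projector d P \<longleftrightarrow> hermitian_op d P \<and> P * P = P"

lemma projector_carrier: "projector d P \<Longrightarrow> P \<in> carrier_mat d d"
  by (simp add: projector_def hermitian_op_def)

lemma hermitian_op_inner:
  assumes P: "hermitian_op d P" and u: "u \<in> carrier_vec d" and v: "v \<in> carrier_vec d"
  shows "(P *\<^sub>v u) \<bullet>c v = u \<bullet>c (P *\<^sub>v v)"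
proof -
  have c: "P \<in> carrier_mat d d" and h: "\<And>i j. i < d \<Longrightarrow> j < d \<Longrightarrow> cnj (P $$ (i, j)) = P $$ (j, i)"
    using P by (auto simp: hermitian_op_iff)
  have "(P *\<^sub>v u) \<bullet>c v = (\<Sum>i<d. \<Sum>j<d. P $$ (i, j) * u $ j * cnj (v $ i))"
    using c u v by (simp add: scalar_prod_def sum_distrib_right lessThan_atLeast0)
  also have "\<dots> = (\<Sum>j<d. \<Sum>i<d. P $$ (i, j) * u $ j * cnj (v $ i))" by (rule sum.swap)
  also have "\<dots> = u \<bullet>c (P *\<^sub>v v)"
    using c u v by (simp add: scalar_prod_def sum_distrib_left lessThan_atLeast0 h mult_ac)
  finally show ?thesis .
qed

text \<open>Idempotence and self-adjointness turn the quadratic form of \<open>P\<close> at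
  \<open>v\<close> into the squared norm of \<open>P *\<^sub>v v\<close>.\<close>

lemma projector_psd:
  assumes "projector d P"
  shows "psd_op d P"
proof -
  have c: "P \<in> carrier_mat d d" using assms by (rule projector_carrier)
  have "0 \<le> (P *\<^sub>v v) \<bullet>c v" if v: "v \<in> carrier_vec d" for v
  proof -
    have "(P *\<^sub>v v) \<bullet>c v = (P *\<^sub>v (P *\<^sub>v v)) \<bullet>c v"
      using assms c v by (simp add: projector_def assoc_mult_mat_vec[symmetric])
    also have "\<dots> = (P *\<^sub>v v) \<bullet>c (P *\<^sub>v v)"
      using assms c v by (intro hermitian_op_inner) (auto simp: projector_def)
    finally show ?thesis using conjugate_square_ge_0_vec c v by simp
  qed
  then show ?thesis using c by (auto simp: psd_op_def)
qed

definition kron :: "complex mat \<Rightarrow> complex mat \<Rightarrow> complex mat" where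
  "kron A B = mat (dim_row A * dim_row B) (dim_col A * dim_col B)
     (\<lambda>(i, j). A $$ (i div dim_row B, j div dim_col B) * B $$ (i mod dim_row B, j mod dim_col B))"

lemma kron_carrier [simp]:
  "A \<in> carrier_mat a a \<Longrightarrow> B \<in> carrier_mat b b \<Longrightarrow> kron A B \<in> carrier_mat (a * b) (a * b)"
  by (auto simp: kron_def)

lemma kron_index:
  assumes "A \<in> carrier_mat a a" "B \<in> carrier_mat b b" "i < a * b" "j < a * b"
  shows "kron A B $$ (i, j) = A $$ (i div b, j div b) * B $$ (i mod b, j mod b)"
  using assms by (simp add: kron_def)

lemma div_mod_less:
  fixes i a b :: nat
  assumes "i < a * b"
  shows "i div b < a" "i mod b < b"
  using assms by (auto simp: less_mult_imp_div_less intro!: mod_less_divisor gr0I)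

lemma div_mod_eq_iff:
  fixes i j b :: nat
  shows "i div b = j div b \<and> i mod b = j mod b \<longleftrightarrow> i = j"
  by (metis div_mult_mod_eq)

lemma tensor_vec_carrier [simp]:
  "u \<in> carrier_vec a \<Longrightarrow> w \<in> carrier_vec b \<Longrightarrow> tensor_vec u w \<in> carrier_vec (a * b)"
  by (auto simp: tensor_vec_def)

lemma tensor_vec_index:
  assumes "w \<in> carrier_vec b" "u \<in> carrier_vec a" "i < a * b"
  shows "tensor_vec u w $ i = u $ (i div b) * w $ (i mod b)"
  using assms by (simp add: tensor_vec_def)

text \<open>\<open>copies\<close> prepends one copy at a time, whereas the swap test acts on pairs.
  With lexicographic labels the regrouping is a literal equality of vectors.\<close>

lemma tensor_vec_assoc: "tensor_vec u (tensor_vec v w) = tensor_vec (tensor_vec u v) w"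
proof (rule eq_vecI)
  fix i assume "i < dim_vec (tensor_vec (tensor_vec u v) w)"
  then have i: "i < dim_vec u * dim_vec v * dim_vec w" by (simp add: tensor_vec_def)
  have d: "i div dim_vec w < dim_vec u * dim_vec v" "i mod (dim_vec v * dim_vec w) < dim_vec v * dim_vec w"
    using i div_mod_less[of i "dim_vec u * dim_vec v" "dim_vec w"]
      div_mod_less[of i "dim_vec u" "dim_vec v * dim_vec w"] by (simp_all add: mult.assoc)
  \<comment> \<open>\<open>t\<close> and \<open>r\<close> are the digits of \<open>i\<close>
    belonging to \<open>v\<close> and \<open>w\<close> when \<open>i\<close> is read in mixed
    radix.\<close>
  define t r where "t = i div dim_vec w mod dim_vec v" and "r = i mod dim_vec w"
  have "r < dim_vec w" unfolding r_def using div_mod_less(2)[OF i] .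
  moreover from this have "dim_vec w \<noteq> 0" by linarith
  moreover have "i mod (dim_vec v * dim_vec w) = t * dim_vec w + r"
    unfolding t_def r_def by (metis mod_mult2_eq mult.commute)
  ultimately have m: "i mod (dim_vec v * dim_vec w) div dim_vec w = t"
    "i mod (dim_vec v * dim_vec w) mod dim_vec w = r" by simp_all
  have "i div (dim_vec v * dim_vec w) = i div dim_vec w div dim_vec v"
    by (metis div_mult2_eq mult.commute)
  then show "tensor_vec u (tensor_vec v w) $ i = tensor_vec (tensor_vec u v) w $ i"
    using i d m by (simp add: tensor_vec_def mult.assoc t_def r_def)
qed (simp add: tensor_vec_def)

lemma kron_mult_tensor_vec:
  assumes A: "A \<in> carrier_mat a a" and B: "B \<in> carrier_mat b b"
    and u: "u \<in> carrier_vec a" and w: "w \<in> carrier_vec b"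
  shows "kron A B *\<^sub>v tensor_vec u w = tensor_vec (A *\<^sub>v u) (B *\<^sub>v w)"
proof (rule eq_vecI)
  fix i assume "i < dim_vec (tensor_vec (A *\<^sub>v u) (B *\<^sub>v w))"
  then have i: "i < a * b" using A B by (simp add: tensor_vec_def)
  note d = div_mod_less[OF i]
  have "(kron A B *\<^sub>v tensor_vec u w) $ i = (\<Sum>j<a * b. kron A B $$ (i, j) * tensor_vec u w $ j)"
    using i kron_carrier[OF A B] tensor_vec_carrier[OF u w] by (simp add: scalar_prod_def lessThan_atLeast0)
  also have "\<dots> = (\<Sum>j<a * b. (\<lambda>x y. (A $$ (i div b, x) * u $ x) * (B $$ (i mod b, y) * w $ y)) (j div b) (j mod b))"
    by (intro sum.cong refl) (simp add: kron_index[OF A B i] tensor_vec_index[OF w u])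
  also have "\<dots> = (\<Sum>x<a. A $$ (i div b, x) * u $ x) * (\<Sum>y<b. B $$ (i mod b, y) * w $ y)"
    by (subst sum_div_mod) (simp add: sum_product)
  also have "\<dots> = tensor_vec (A *\<^sub>v u) (B *\<^sub>v w) $ i"
    using A B u w i d by (simp add: tensor_vec_def scalar_prod_def lessThan_atLeast0)
  finally show "(kron A B *\<^sub>v tensor_vec u w) $ i = tensor_vec (A *\<^sub>v u) (B *\<^sub>v w) $ i" .
qed (use A B in \<open>simp add: kron_def tensor_vec_def\<close>)

lemma tensor_vec_inner:
  assumes u: "u \<in> carrier_vec a" "u' \<in> carrier_vec a" and w: "w \<in> carrier_vec b" "w' \<in> carrier_vec b"
  shows "tensor_vec u w \<bullet>c tensor_vec u' w' = (u \<bullet>c u') * (w \<bullet>c w')"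
proof -
  have "tensor_vec u w \<bullet>c tensor_vec u' w'
    = (\<Sum>j<a * b. (\<lambda>x y. (u $ x * cnj (u' $ x)) * (w $ y * cnj (w' $ y))) (j div b) (j mod b))"
    using tensor_vec_carrier[OF u(2) w(2)]
    by (simp add: scalar_prod_def lessThan_atLeast0[symmetric] mult_ac
        tensor_vec_index[OF w(1) u(1)] tensor_vec_index[OF w(2) u(2)])
  also have "\<dots> = (u \<bullet>c u') * (w \<bullet>c w')"
    using u w by (subst sum_div_mod) (simp add: sum_product scalar_prod_def lessThan_atLeast0)
  finally show ?thesis .
qed

lemma kron_mult:
  assumes A: "A \<in> carrier_mat a a" "A' \<in> carrier_mat a a" and B: "B \<in> carrier_mat b b" "B' \<in> carrier_mat b b"
  shows "kron A B * kron A' B' = kron (A * A') (B * B')"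
proof (rule eq_matI)
  fix i j assume "i < dim_row (kron (A * A') (B * B'))" "j < dim_col (kron (A * A') (B * B'))"
  then have i: "i < a * b" and j: "j < a * b" using A B by (auto simp: kron_def)
  note d = div_mod_less[OF i] div_mod_less[OF j]
  have "(kron A B * kron A' B') $$ (i, j) = (\<Sum>x<a * b. kron A B $$ (i, x) * kron A' B' $$ (x, j))"
    using i j kron_carrier[OF A(1) B(1)] kron_carrier[OF A(2) B(2)]
    by (simp add: scalar_prod_def lessThan_atLeast0)
  also have "\<dots> = (\<Sum>x<a * b. (\<lambda>x y. (A $$ (i div b, x) * A' $$ (x, j div b)) *
      (B $$ (i mod b, y) * B' $$ (y, j mod b))) (x div b) (x mod b))"
    by (intro sum.cong refl) (simp add: kron_index[OF A(1) B(1) i] kron_index[OF A(2) B(2) _ j])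
  also have "\<dots> = (A * A') $$ (i div b, j div b) * (B * B') $$ (i mod b, j mod b)"
    using A B d by (subst sum_div_mod) (simp add: sum_product scalar_prod_def lessThan_atLeast0)
  also have "\<dots> = kron (A * A') (B * B') $$ (i, j)"
    using A B i j by (intro kron_index[symmetric]) auto
  finally show "(kron A B * kron A' B') $$ (i, j) = kron (A * A') (B * B') $$ (i, j)" .
qed (use A B in \<open>auto simp: kron_def\<close>)

lemma projector_kron:
  assumes "projector a P" "projector b R"
  shows "projector (a * b) (kron P R)"
proof -
  have c: "P \<in> carrier_mat a a" "R \<in> carrier_mat b b"
    using assms by (auto intro: projector_carrier)
  have "cnj (kron P R $$ (j, i)) = kron P R $$ (i, j)" if "i < a * b" "j < a * b" for i j
    using assms div_mod_less[OF that(1)] div_mod_less[OF that(2)]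
    by (simp add: kron_index[OF c] that projector_def hermitian_op_iff)
  then show ?thesis using assms c by (auto simp: projector_def hermitian_op_iff kron_mult)
qed

section \<open>Product measurements\<close>

text \<open>The effect of the outcome string \<open>j\<close> when the measurement \<open>P\<close>
  is applied separately to \<open>M\<close> blocks. The binary digits of \<open>j\<close> are
  consumed in the same order as in \<open>seq_weight\<close>.\<close>

primrec product_effect :: "(nat \<Rightarrow> complex mat) \<Rightarrow> nat \<Rightarrow> nat \<Rightarrow> complex mat" where
  "product_effect P 0 j = 1\<^sub>m 1"
| "product_effect P (Suc M) j = kron (P (j mod 2)) (product_effect P M (j div 2))"

lemma projector_product_effect:
  assumes "\<And>b. projector d (P b)"
  shows "projector (d ^ M) (product_effect P M j)"
proof (induction M arbitrary: j)
  case 0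
  then show ?case by (auto simp: projector_def hermitian_op_iff)
qed (simp add: assms projector_kron)

text \<open>Summing over the first digit replaces the leading factor by \<open>P 0 + P 1\<close>,
  the identity. By induction the whole sum is a Kronecker product of identities.\<close>

lemma povm_product_effect:
  assumes P: "\<And>b. projector d (P b)" and sum: "P 0 + P 1 = 1\<^sub>m d"
  shows "povm (d ^ M) (2 ^ M) (product_effect P M)"
proof -
  note proj = projector_product_effect[OF P]
  have c: "P b \<in> carrier_mat d d" for b by (rule projector_carrier[OF P])
  have c': "product_effect P M j \<in> carrier_mat (d ^ M) (d ^ M)" for j M by (rule projector_carrier[OF proj])
  have P01: "P 0 $$ (x, y) + P (Suc 0) $$ (x, y) = (if x = y then 1 else 0)" if "x < d" "y < d" for x y
    using that c[of 0] c[of 1] arg_cong[OF sum, of "\<lambda>A. A $$ (x, y)"] by simp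
  have "(\<Sum>j<2 ^ M. product_effect P M j $$ (x, y)) = (if x = y then 1 else 0)"
    if "x < d ^ M" "y < d ^ M" for x y
    using that
  proof (induction M arbitrary: x y)
    case (Suc M)
    then have x: "x < d * d ^ M" and y: "y < d * d ^ M" by auto
    note b = div_mod_less[OF x] div_mod_less[OF y]
    have "(\<Sum>j<2 ^ Suc M. product_effect P (Suc M) j $$ (x, y))
      = (\<Sum>j<2 ^ Suc M. (\<lambda>b i. P b $$ (x div d ^ M, y div d ^ M) *
          product_effect P M i $$ (x mod d ^ M, y mod d ^ M)) (j mod 2) (j div 2))"
      by (intro sum.cong refl) (simp add: kron_index[OF c c' x y])
    also have "\<dots> = (P 0 $$ (x div d ^ M, y div d ^ M) + P 1 $$ (x div d ^ M, y div d ^ M)) *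
        (\<Sum>i<2 ^ M. product_effect P M i $$ (x mod d ^ M, y mod d ^ M))"
      by (subst sum_pow2_Suc) (simp add: distrib_right sum_distrib_left sum.distrib)
    also have "\<dots> = (if x div d ^ M = y div d ^ M \<and> x mod d ^ M = y mod d ^ M then 1 else 0)"
      using b by (simp add: P01 Suc.IH)
    also have "\<dots> = (if x = y then 1 else 0)"
      by (simp only: div_mod_eq_iff)
    finally show ?case .
  qed auto
  then show ?thesis using proj by (auto simp: povm_def projector_psd)
qed

lemma copies_carrier [simp]: "v \<in> carrier_vec d \<Longrightarrow> copies m v \<in> carrier_vec (d ^ m)"
  by (induction m) auto

text \<open>Blocks of a product state are independent: the expectation of a Kronecker product is the
  product of the expectations, one factor per pair of copies.\<close>

lemma product_effect_expectation:
  assumes P: "\<And>b. projector (D * D) (P b)" and v: "v \<in> carrier_vec D"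
    and q: "\<And>b. (P b *\<^sub>v tensor_vec v v) \<bullet>c tensor_vec v v = complex_of_real (q b)"
  shows "(product_effect P M j *\<^sub>v copies (2 * M) v) \<bullet>c copies (2 * M) v = complex_of_real (seq_weight q M j)"
proof (induction M arbitrary: j)
  case 0
  then show ?case by (simp add: scalar_prod_def)
next
  case (Suc M)
  let ?u = "tensor_vec v v" and ?w = "copies (2 * M) v"
  let ?E = "product_effect P M (j div 2)" and ?P = "P (j mod 2)"
  have cw: "?w \<in> carrier_vec ((D * D) ^ M)"
    using copies_carrier[OF v, of "2 * M"] by (simp add: power_mult power2_eq_square)
  have cu: "?u \<in> carrier_vec (D * D)" using v by simp
  have cP: "?P \<in> carrier_mat (D * D) (D * D)" by (rule projector_carrier[OF P])
  have cE: "?E \<in> carrier_mat ((D * D) ^ M) ((D * D) ^ M)"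
    by (rule projector_carrier[OF projector_product_effect[OF P]])
  \<comment> \<open>Two unfoldings of \<open>copies\<close> put two copies in front. Associativity
    groups them into the pair on which the next factor acts.\<close>
  have "copies (2 * Suc M) v = tensor_vec ?u ?w" by (simp add: tensor_vec_assoc)
  then have "(product_effect P (Suc M) j *\<^sub>v copies (2 * Suc M) v) \<bullet>c copies (2 * Suc M) v
    = tensor_vec (?P *\<^sub>v ?u) (?E *\<^sub>v ?w) \<bullet>c tensor_vec ?u ?w"
    by (simp add: kron_mult_tensor_vec[OF cP cE cu cw])
  also have "\<dots> = ((?P *\<^sub>v ?u) \<bullet>c ?u) * ((?E *\<^sub>v ?w) \<bullet>c ?w)"
    using cP cE cu cw by (intro tensor_vec_inner) auto
  finally show ?case by (simp add: q Suc)
qed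


section \<open>The swap test\<close>

text \<open>If \<open>T\<close> squares to the identity, then so does its negative, and
  \<open>(1 + T)^2 = 2 (1 + T)\<close>, so half of \<open>1 + T\<close> is idempotent. The two signs
  give the projectors onto the eigenspaces of \<open>S\<close> for 1 and -1.\<close>

lemma projector_of_involution:
  fixes \<sigma> :: real
  assumes S: "hermitian_op d S" "S * S = 1\<^sub>m d" and \<sigma>: "\<sigma>\<^sup>2 = 1"
  shows "projector d ((1 / 2) \<cdot>\<^sub>m (1\<^sub>m d + complex_of_real \<sigma> \<cdot>\<^sub>m S))" (is "projector d ?P")
proof -
  have c: "S \<in> carrier_mat d d" and h: "\<And>i j. i < d \<Longrightarrow> j < d \<Longrightarrow> cnj (S $$ (j, i)) = S $$ (i, j)"
    using S by (auto simp: hermitian_op_iff)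
  have \<sigma>': "complex_of_real \<sigma> * complex_of_real \<sigma> = 1"
    using \<sigma> by (metis of_real_1 of_real_mult power2_eq_square)
  let ?T = "complex_of_real \<sigma> \<cdot>\<^sub>m S"
  have cT: "?T \<in> carrier_mat d d" using c by simp
  have TT: "?T * ?T = 1\<^sub>m d"
    unfolding mult_smult_assoc_mat[OF c cT] mult_smult_distrib[OF c c] S(2)
    using \<sigma>' by (intro eq_matI) auto
  have "(1\<^sub>m d + ?T) * (1\<^sub>m d + ?T) = (1\<^sub>m d + ?T) + (?T + 1\<^sub>m d)"
    using c cT TT add_mult_distrib_mat[of "1\<^sub>m d" d d ?T "1\<^sub>m d + ?T" d]
      mult_add_distrib_mat[of ?T d d "1\<^sub>m d" d ?T]
    by simp
  also have "\<dots> = 2 \<cdot>\<^sub>m (1\<^sub>m d + ?T)"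
    using c by (intro eq_matI) (auto simp: algebra_simps)
  finally have sq: "(1\<^sub>m d + ?T) * (1\<^sub>m d + ?T) = 2 \<cdot>\<^sub>m (1\<^sub>m d + ?T)" .
  have c1: "1\<^sub>m d + ?T \<in> carrier_mat d d" using c by simp
  have "?P * ?P = ?P"
    unfolding mult_smult_assoc_mat[OF c1 smult_carrier_mat[OF c1]] mult_smult_distrib[OF c1 c1] sq
    by (intro eq_matI) auto
  moreover have "hermitian_op d ?P"
    using c h by (auto simp: hermitian_op_iff)
  ultimately show ?thesis by (simp add: projector_def)
qed

lemma involution_projector_inner:
  fixes S :: "complex mat"
  assumes S: "S \<in> carrier_mat d d" and u: "u \<in> carrier_vec d"
  shows "(((1 / 2) \<cdot>\<^sub>m (1\<^sub>m d + s \<cdot>\<^sub>m S)) *\<^sub>v u) \<bullet>c u = (u \<bullet>c u + s * ((S *\<^sub>v u) \<bullet>c u)) / 2"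
proof -
  have "((1 / 2) \<cdot>\<^sub>m (1\<^sub>m d + s \<cdot>\<^sub>m S)) *\<^sub>v u = (1 / 2) \<cdot>\<^sub>v (u + s \<cdot>\<^sub>v (S *\<^sub>v u))"
  proof (rule eq_vecI)
    fix i assume i: "i < dim_vec ((1 / 2) \<cdot>\<^sub>v (u + s \<cdot>\<^sub>v (S *\<^sub>v u)))"
    then have i': "i < d" using S by simp
    have "row ((1 / 2) \<cdot>\<^sub>m (1\<^sub>m d + s \<cdot>\<^sub>m S)) i = (1 / 2) \<cdot>\<^sub>v (unit_vec d i + s \<cdot>\<^sub>v row S i)"
      using S i' by (intro eq_vecI) auto
    then show "(((1 / 2) \<cdot>\<^sub>m (1\<^sub>m d + s \<cdot>\<^sub>m S)) *\<^sub>v u) $ i = ((1 / 2) \<cdot>\<^sub>v (u + s \<cdot>\<^sub>v (S *\<^sub>v u))) $ i"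
      using S u i' by (simp add: add_scalar_prod_distrib[of _ d])
  qed (use S in simp)
  then show ?thesis
    using S u by (simp add: add_scalar_prod_distrib[of _ d])
qed

text \<open>A label \<open>k\<close> of a single copy splits into its part \<open>a k\<close> on \<open>A\<close> and its part \<open>b k\<close> on \<open>B\<close>;
  a label of two copies is \<open>k * D + l\<close>.\<close>

definition partial_swap :: "nat \<Rightarrow> (nat \<Rightarrow> nat) \<Rightarrow> (nat \<Rightarrow> nat) \<Rightarrow> complex mat" where
  "partial_swap D a b = mat (D * D) (D * D) (\<lambda>(i, j).
     of_bool (a (i div D) = a (j mod D) \<and> b (i div D) = b (j div D) \<and>
              a (i mod D) = a (j div D) \<and> b (i mod D) = b (j mod D)))"

lemma partial_swap_carrier [simp]: "partial_swap D a b \<in> carrier_mat (D * D) (D * D)"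
  by (simp add: partial_swap_def)

lemma hermitian_partial_swap: "hermitian_op (D * D) (partial_swap D a b)"
  by (auto simp: hermitian_op_iff partial_swap_def)

text \<open>The two hypotheses say that the labels form a full product of \<open>A\<close> parts and
  \<open>B\<close> parts. Exchanging the \<open>A\<close> parts is then a permutation of the labels
  of two copies, and doing it twice restores every label.\<close>

lemma partial_swap_involution:
  assumes inj: "inj_on (\<lambda>k. (a k, b k)) {..<D}"
    and glue: "\<And>k l. k < D \<Longrightarrow> l < D \<Longrightarrow> \<exists>m<D. a m = a k \<and> b m = b l"
  shows "partial_swap D a b * partial_swap D a b = 1\<^sub>m (D * D)"
proof (rule eq_matI)
  fix i j assume "i < dim_row (1\<^sub>m (D * D))" "j < dim_col (1\<^sub>m (D * D))"
  then have i: "i < D * D" and j: "j < D * D" by auto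
  let ?S = "partial_swap D a b"
  note d = div_mod_less[OF i] div_mod_less[OF j]
  have eqI: "k = l" if "k < D" "l < D" "a k = a l" "b k = b l" for k l
    using inj that by (auto dest: inj_onD)
  \<comment> \<open>\<open>k\<close> joins the \<open>A\<close> part of the second copy to the
    \<open>B\<close> part of the first, and \<open>l\<close> does the opposite. Hence
    \<open>x\<close> is the label \<open>i\<close> with the \<open>A\<close> parts exchanged, and
    row \<open>i\<close> has its only nonzero entry at \<open>x\<close>.\<close>
  obtain k where k: "k < D" "a k = a (i mod D)" "b k = b (i div D)"
    using glue d by metis
  obtain l where l: "l < D" "a l = a (i div D)" "b l = b (i mod D)"
    using glue d by metis
  define x where "x = k * D + l"
  have x: "x < D * D" "x div D = k" "x mod D = l"
    using k l by (auto simp: x_def nat_add_mult_less)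
  have ix: "?S $$ (i, y) = of_bool (y = x)" if y: "y < D * D" for y
  proof -
    have "a (i div D) = a (y mod D) \<and> b (i div D) = b (y div D) \<and>
        a (i mod D) = a (y div D) \<and> b (i mod D) = b (y mod D) \<longleftrightarrow> y div D = k \<and> y mod D = l"
      using eqI[OF div_mod_less(1)[OF y] k(1)] eqI[OF div_mod_less(2)[OF y] l(1)]
      by (metis k(2,3) l(2,3))
    also have "\<dots> \<longleftrightarrow> y = x"
      using x by (metis div_mult_mod_eq)
    finally show ?thesis using i y by (simp add: partial_swap_def)
  qed
  have "(?S * ?S) $$ (i, j) = (\<Sum>y<D * D. ?S $$ (i, y) * ?S $$ (y, j))"
    using i j carrier_matD[OF partial_swap_carrier[of D a b]]
    by (simp add: scalar_prod_def lessThan_atLeast0)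
  also have "\<dots> = (\<Sum>y<D * D. of_bool (y = x) * ?S $$ (y, j))"
    by (intro sum.cong refl) (simp add: ix)
  also have "\<dots> = ?S $$ (x, j)"
    using x by (simp add: of_bool_def if_distrib[of "\<lambda>c. c * _"] sum.delta cong: if_cong)
  also have "\<dots> = of_bool (a k = a (j mod D) \<and> b k = b (j div D) \<and> a l = a (j div D) \<and> b l = b (j mod D))"
    using x j by (simp add: partial_swap_def)
  also have "\<dots> = of_bool (i div D = j div D \<and> i mod D = j mod D)"
    using eqI[OF d(1,3)] eqI[OF d(2,4)] unfolding k(2,3) l(2,3) by (intro arg_cong[where f = of_bool]) auto
  also have "\<dots> = of_bool (i = j)"
    by (simp only: div_mod_eq_iff)
  finally show "(?S * ?S) $$ (i, j) = 1\<^sub>m (D * D) $$ (i, j)"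
    using i j by simp
qed (simp_all add: partial_swap_def)

text \<open>Matrix entries group the labels by rows \<open>l\<close>, \<open>l'\<close> and columns
  \<open>k\<close>, \<open>k'\<close>. The purity groups them by copy, as \<open>k\<close>,
  \<open>l\<close> and \<open>k'\<close>, \<open>l'\<close>.\<close>

lemma sum_swap_middle:
  fixes h :: "'a \<Rightarrow> 'a \<Rightarrow> 'a \<Rightarrow> 'a \<Rightarrow> 'b::comm_monoid_add"
  shows "(\<Sum>l\<in>K. \<Sum>l'\<in>K. \<Sum>k\<in>K. \<Sum>k'\<in>K. h k l k' l') = (\<Sum>k\<in>K. \<Sum>l\<in>K. \<Sum>k'\<in>K. \<Sum>l'\<in>K. h k l k' l')"
proof -
  have "(\<Sum>l\<in>K. \<Sum>l'\<in>K. \<Sum>k\<in>K. \<Sum>k'\<in>K. h k l k' l') = (\<Sum>l\<in>K. \<Sum>k\<in>K. \<Sum>l'\<in>K. \<Sum>k'\<in>K. h k l k' l')"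
    by (intro sum.cong refl sum.swap)
  also have "\<dots> = (\<Sum>k\<in>K. \<Sum>l\<in>K. \<Sum>l'\<in>K. \<Sum>k'\<in>K. h k l k' l')"
    by (rule sum.swap)
  also have "\<dots> = (\<Sum>k\<in>K. \<Sum>l\<in>K. \<Sum>k'\<in>K. \<Sum>l'\<in>K. h k l k' l')"
    by (intro sum.cong refl sum.swap)
  finally show ?thesis .
qed

text \<open>The summand is arranged as a product of two density matrix entries, at
  \<open>(k, l)\<close> and \<open>(k', l')\<close>, for comparison with the purity.\<close>

lemma partial_swap_expectation:
  assumes v: "v \<in> carrier_vec D"
  shows "(partial_swap D a b *\<^sub>v tensor_vec v v) \<bullet>c tensor_vec v v =
    (\<Sum>k<D. \<Sum>l<D. \<Sum>k'<D. \<Sum>l'<D. of_bool (a l = a k' \<and> b l = b k \<and> a l' = a k \<and> b l' = b k') *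
       (v $ k * cnj (v $ l) * (v $ k' * cnj (v $ l'))))"
proof -
  define c where "c l l' k k' = of_bool (a l = a k' \<and> b l = b k \<and> a l' = a k \<and> b l' = b k') *
       (v $ k * cnj (v $ l) * (v $ k' * cnj (v $ l')))" for l l' k k'
  let ?S = "partial_swap D a b" and ?u = "tensor_vec v v"
  have cu: "?u \<in> carrier_vec (D * D)" using v by simp
  have "(?S *\<^sub>v ?u) \<bullet>c ?u = (\<Sum>i<D * D. \<Sum>j<D * D. ?S $$ (i, j) * ?u $ j * cnj (?u $ i))"
    using carrier_matD[OF partial_swap_carrier[of D a b]] carrier_vecD[OF cu]
    by (simp add: scalar_prod_def sum_distrib_right lessThan_atLeast0)
  also have "\<dots> = (\<Sum>i<D * D. \<Sum>j<D * D. c (i div D) (i mod D) (j div D) (j mod D))"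
    by (intro sum.cong refl) (simp add: tensor_vec_index[OF v v] partial_swap_def c_def)
  also have "\<dots> = (\<Sum>i<D * D. (\<lambda>l l'. \<Sum>k<D. \<Sum>k'<D. c l l' k k') (i div D) (i mod D))"
    by (simp only: sum_div_mod)
  also have "\<dots> = (\<Sum>l<D. \<Sum>l'<D. \<Sum>k<D. \<Sum>k'<D. c l l' k k')"
    by (rule sum_div_mod)
  also have "\<dots> = (\<Sum>k<D. \<Sum>l<D. \<Sum>k'<D. \<Sum>l'<D. c l l' k k')"
    by (rule sum_swap_middle)
  finally show ?thesis by (simp add: c_def)
qed

section \<open>Splitting labels into sites\<close>

text \<open>The exponent of a digit counts the later sites in the set. A new smallest site comes
  after none of the others, so the old exponents stay and the new digit becomes the leading
  one.\<close>

lemma sub_index_insert: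
  assumes "finite S" "\<forall>j\<in>S. i < j"
  shows "sub_index n (insert i S) k = site_digit n k i * 4 ^ card S + sub_index n S k"
proof -
  have "i \<notin> S" using assms by auto
  moreover have "{j \<in> insert i S. i < j} = S" using assms by auto
  moreover have "{j' \<in> insert i S. j < j'} = {j' \<in> S. j < j'}" if "j \<in> S" for j
    using assms that by auto
  ultimately show ?thesis
    using assms by (simp add: sub_index_def)
qed

lemma sub_index_less:
  assumes "finite S"
  shows "sub_index n S k < 4 ^ card S"
  using assms
proof (induction S rule: finite_linorder_min_induct)
  case (insert i S)
  have "site_digit n k i < 4" by (simp add: site_digit_def)
  from nat_add_mult_less[OF this insert.IH] show ?case
    using insert.hyps by (subst sub_index_insert) auto
qed (simp add: sub_index_def)

lemma sub_index_eqD: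
  assumes "finite S" "sub_index n S k = sub_index n S l" "i \<in> S"
  shows "site_digit n k i = site_digit n l i"
  using assms
proof (induction S rule: finite_linorder_min_induct)
  case (insert j S)
  let ?b = "4 ^ card S"
  have eq: "site_digit n k j * ?b + sub_index n S k = site_digit n l j * ?b + sub_index n S l"
    using insert by (simp add: sub_index_insert)
  have less: "sub_index n S k < ?b" "sub_index n S l < ?b"
    using insert by (simp_all add: sub_index_less)
  have "site_digit n k j = site_digit n l j"
    using less arg_cong[OF eq, of "\<lambda>x. x div ?b"] by simp
  moreover have "sub_index n S k = sub_index n S l"
    using less arg_cong[OF eq, of "\<lambda>x. x mod ?b"] by simp
  ultimately show ?case using insert by auto
qed simp

lemma mod_pow_eqI:
  fixes k l b :: nat
  assumes "\<And>e. e < n \<Longrightarrow> k div b ^ e mod b = l div b ^ e mod b"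
  shows "k mod b ^ n = l mod b ^ n"
  using assms
proof (induction n)
  case (Suc n)
  have "x mod b ^ Suc n = b ^ n * (x div b ^ n mod b) + x mod b ^ n" for x
    using mod_mult2_eq[of x "b ^ n" b] by (simp add: mult.commute)
  then show ?case using Suc by simp
qed simp

text \<open>The labels on \<open>A\<close> and \<open>B\<close> determine the digit at every site,
  hence the number modulo \<open>4 ^ n\<close>, which is the number itself in this range.\<close>

lemma bipartition_inj:
  assumes "bipartition n A B"
  shows "inj_on (\<lambda>k. (sub_index n A k, sub_index n B k)) {..<4 ^ n}"
proof (rule inj_onI)
  fix k l assume k: "k \<in> {..<4 ^ n}" "l \<in> {..<4 ^ n}"
    and eq: "(sub_index n A k, sub_index n B k) = (sub_index n A l, sub_index n B l)"
  have AB: "A \<union> B = {1..n}" using assms by (simp add: bipartition_def)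
  then have fin: "finite A" "finite B" by (metis finite_Un finite_atLeastAtMost)+
  have dig: "site_digit n k i = site_digit n l i" if "i \<in> {1..n}" for i
    using that eq fin unfolding AB[symmetric] by (auto dest: sub_index_eqD)
  have "k mod 4 ^ n = l mod 4 ^ n"
  proof (rule mod_pow_eqI)
    fix e assume "e < n"
    \<comment> \<open>Site 1 is the most significant digit, so the digit of weight
      \<open>4 ^ e\<close> sits at site \<open>n - e\<close>.\<close>
    then show "k div 4 ^ e mod 4 = l div 4 ^ e mod 4"
      using dig[of "n - e"] by (simp add: site_digit_def)
  qed
  then show "k = l" using k by simp
qed

text \<open>Proved by counting: the injective splitting map goes into a set with
  \<open>4 ^ card A * 4 ^ card B = 4 ^ n\<close> elements, so it is onto.\<close>

lemma bipartition_glue: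
  assumes bip: "bipartition n A B" and k: "k < 4 ^ n" "l < 4 ^ n"
  shows "\<exists>m<4 ^ n. sub_index n A m = sub_index n A k \<and> sub_index n B m = sub_index n B l"
proof -
  let ?g = "\<lambda>k. (sub_index n A k, sub_index n B k)"
  have AB: "A \<union> B = {1..n}" "A \<inter> B = {}" using bip by (auto simp: bipartition_def)
  then have fin: "finite A" "finite B" by (metis finite_Un finite_atLeastAtMost)+
  have card: "card A + card B = n" using AB fin card_Un_disjoint by fastforce
  have "?g ` {..<4 ^ n} = {..<4 ^ card A} \<times> {..<4 ^ card B}"
  proof (rule card_subset_eq)
    show "card (?g ` {..<4 ^ n}) = card ({..<4 ^ card A} \<times> {..<4 ^ card B} :: (nat \<times> nat) set)"
      using card_image[OF bipartition_inj[OF bip]] card by (simp add: power_add[symmetric])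
  qed (auto simp: sub_index_less fin)
  moreover have "(sub_index n A k, sub_index n B l) \<in> {..<4 ^ card A} \<times> {..<4 ^ card B}"
    by (simp add: sub_index_less fin)
  ultimately have "(sub_index n A k, sub_index n B l) \<in> ?g ` {..<4 ^ n}" by simp
  then show ?thesis by (auto simp: image_iff)
qed

text \<open>Both sides expand to the same sum over four labels. The product of the two reduced
  matrices links their \<open>A\<close> labels crosswise, and each partial trace equates the
  \<open>B\<close> labels inside one copy.\<close>

lemma purity_eq_partial_swap:
  assumes bip: "bipartition n A B" and v: "v \<in> carrier_vec (4 ^ n)"
  shows "mat_trace (partial_trace n A B (pure_density v) * partial_trace n A B (pure_density v)) =
    (partial_swap (4 ^ n) (sub_index n A) (sub_index n B) *\<^sub>v tensor_vec v v) \<bullet>c tensor_vec v v"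
proof -
  let ?a = "sub_index n A" and ?b = "sub_index n B" and ?D = "4 ^ n :: nat" and ?d = "4 ^ card A :: nat"
  let ?\<rho> = "partial_trace n A B (pure_density v)"
  let ?K = "{..<?D} \<times> {..<?D}" and ?X = "{..<?d} \<times> {..<?d}"
  have "finite A" using bip by (metis bipartition_def finite_Un finite_atLeastAtMost)
  then have a_less: "?a k < ?d" for k by (rule sub_index_less)
  \<comment> \<open>A pair of labels contributes \<open>g\<close> to the single entry of the reduced
    matrix at position \<open>r\<close>. The indicator in \<open>g\<close> is the \<open>B\<close>
    constraint of the partial trace.\<close>
  define g where "g = (\<lambda>(k, l). of_bool (?b k = ?b l) * (v $ k * cnj (v $ l)))"
  define r where "r = (\<lambda>(k, l). (?a k, ?a l))"
  have \<rho>: "?\<rho> $$ p = (\<Sum>q\<in>?K. of_bool (r q = p) * g q)" if "p \<in> ?X" for p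
  proof -
    have "?\<rho> $$ p = (\<Sum>(k, l) \<in> {q \<in> ?K. r q = p \<and> ?b (fst q) = ?b (snd q)}. pure_density v $$ (k, l))"
      using that by (auto simp: partial_trace_def r_def intro!: sum.cong)
    also have "\<dots> = (\<Sum>q\<in>?K. of_bool (r q = p) * g q)"
      unfolding sum.inter_filter[OF finite_cartesian_product[OF finite_lessThan finite_lessThan]]
      using v by (intro sum.cong refl) (auto simp: g_def pure_density_def)
    finally show ?thesis .
  qed
  have cr: "?\<rho> \<in> carrier_mat ?d ?d" by (simp add: partial_trace_def)
  have "mat_trace (?\<rho> * ?\<rho>) = (\<Sum>x<?d. \<Sum>y<?d. ?\<rho> $$ (x, y) * ?\<rho> $$ (y, x))"
    using cr by (simp add: mat_trace_def scalar_prod_def lessThan_atLeast0)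
  also have "\<dots> = (\<Sum>p\<in>?X. ?\<rho> $$ p * ?\<rho> $$ prod.swap p)"
    by (simp add: sum.cartesian_product case_prod_unfold prod.swap_def)
  also have "\<dots> = (\<Sum>p\<in>?X. (\<Sum>q\<in>?K. of_bool (r q = p) * g q) * (\<Sum>q'\<in>?K. of_bool (r q' = prod.swap p) * g q'))"
    by (intro sum.cong refl arg_cong2[of _ _ _ _ "(*)"] \<rho>) auto
  also have "\<dots> = (\<Sum>p\<in>?X. \<Sum>q\<in>?K. \<Sum>q'\<in>?K. of_bool (r q = p) * g q * (of_bool (r q' = prod.swap p) * g q'))"
    by (simp only: sum_product)
  also have "\<dots> = (\<Sum>q\<in>?K. \<Sum>p\<in>?X. \<Sum>q'\<in>?K. of_bool (r q = p) * g q * (of_bool (r q' = prod.swap p) * g q'))"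
    by (rule sum.swap)
  also have "\<dots> = (\<Sum>q\<in>?K. \<Sum>q'\<in>?K. \<Sum>p\<in>?X. of_bool (r q = p) * g q * (of_bool (r q' = prod.swap p) * g q'))"
    by (intro sum.cong refl sum.swap)
  \<comment> \<open>Only \<open>p = r q\<close> survives in the inner sum, and it lies in the range
    because labels on \<open>A\<close> are below \<open>4 ^ card A\<close>.\<close>
  also have "\<dots> = (\<Sum>q\<in>?K. \<Sum>q'\<in>?K. of_bool (r q' = prod.swap (r q)) * (g q * g q'))"
  proof (intro sum.cong refl)
    fix q q'
    have "r q \<in> ?X" by (auto simp: r_def a_less split: prod.split)
    have "(\<Sum>p\<in>?X. of_bool (r q = p) * g q * (of_bool (r q' = prod.swap p) * g q'))
      = (\<Sum>p\<in>?X. if r q = p then g q * (of_bool (r q' = prod.swap p) * g q') else 0)"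
      by (intro sum.cong refl) simp
    also have "\<dots> = g q * (of_bool (r q' = prod.swap (r q)) * g q')"
      using \<open>r q \<in> ?X\<close> by (subst sum.delta') auto
    finally show "(\<Sum>p\<in>?X. of_bool (r q = p) * g q * (of_bool (r q' = prod.swap p) * g q'))
      = of_bool (r q' = prod.swap (r q)) * (g q * g q')" by simp
  qed
  also have "\<dots> = (\<Sum>k<?D. \<Sum>l<?D. \<Sum>k'<?D. \<Sum>l'<?D.
      of_bool (r (k', l') = prod.swap (r (k, l))) * (g (k, l) * g (k', l')))"
    by (simp only: sum.cartesian_product')
  also have "\<dots> = (partial_swap ?D ?a ?b *\<^sub>v tensor_vec v v) \<bullet>c tensor_vec v v"
    unfolding partial_swap_expectation[OF v]
    by (intro sum.cong refl) (auto simp: r_def g_def)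
  finally show ?thesis .
qed

section \<open>Normalization of the vectorization\<close>

lemma vectorization_carrier [simp]: "vectorization n N Q X \<in> carrier_vec (4 ^ n)"
  by (simp add: vectorization_def)

text \<open>Taking the trace against the adjoint of \<open>Q k\<close> removes every term of the
  expansion but the \<open>k\<close>-th, which keeps the factor \<open>N\<close>.\<close>

lemma op_coeff_expansion:
  assumes Q: "orthogonal_operator_basis n N Q" and k: "k < 4 ^ n"
    and Y: "Y = mat (2 ^ n) (2 ^ n) (\<lambda>(i, j). \<Sum>l<4 ^ n. c $ l * Q l $$ (i, j))"
  shows "op_coeff N Q Y k = c $ k"
proof -
  let ?d = "2 ^ n :: nat"
  have cQ: "\<And>l. l < 4 ^ n \<Longrightarrow> Q l \<in> carrier_mat ?d ?d" and N: "N > 0"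
    and orth: "\<And>l. l < 4 ^ n \<Longrightarrow> mat_trace (mat_adjoint (Q k) * Q l) = (if k = l then complex_of_real N else 0)"
    using Q k by (auto simp: orthogonal_operator_basis_def)
  have tr: "mat_trace (mat_adjoint (Q k) * Z) = (\<Sum>i<?d. \<Sum>j<?d. cnj (Q k $$ (j, i)) * Z $$ (j, i))"
    if "Z \<in> carrier_mat ?d ?d" for Z
    using that cQ[OF k] carrier_matD[OF mat_adjoint_carrier[OF cQ[OF k]]]
    by (simp add: mat_trace_def scalar_prod_def lessThan_atLeast0)
  have "mat_trace (mat_adjoint (Q k) * Y)
    = (\<Sum>i<?d. \<Sum>j<?d. \<Sum>l<4 ^ n. c $ l * (cnj (Q k $$ (j, i)) * Q l $$ (j, i)))"
    by (subst tr) (simp_all add: Y sum_distrib_left mult_ac)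
  also have "\<dots> = (\<Sum>i<?d. \<Sum>l<4 ^ n. \<Sum>j<?d. c $ l * (cnj (Q k $$ (j, i)) * Q l $$ (j, i)))"
    by (intro sum.cong refl sum.swap)
  also have "\<dots> = (\<Sum>l<4 ^ n. \<Sum>i<?d. \<Sum>j<?d. c $ l * (cnj (Q k $$ (j, i)) * Q l $$ (j, i)))"
    by (rule sum.swap)
  also have "\<dots> = (\<Sum>l<4 ^ n. c $ l * mat_trace (mat_adjoint (Q k) * Q l))"
    by (intro sum.cong refl) (simp add: tr cQ sum_distrib_left)
  also have "\<dots> = (\<Sum>l<4 ^ n. if k = l then c $ l * complex_of_real N else 0)"
    by (intro sum.cong refl) (simp add: orth)
  also have "\<dots> = c $ k * complex_of_real N" using k by simp
  finally show ?thesis using N by (simp add: op_coeff_def)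
qed

text \<open>If all coefficients vanished, the expansion would make \<open>Y\<close> zero. So the
  normalizing square root is positive and the division by it is genuine.\<close>

lemma vectorization_unit:
  assumes Q: "orthogonal_operator_basis n N Q" and Y: "Y \<in> carrier_mat (2 ^ n) (2 ^ n)" "Y \<noteq> 0\<^sub>m (2 ^ n) (2 ^ n)"
  shows "vectorization n N Q Y \<bullet>c vectorization n N Q Y = 1"
proof -
  let ?s = "\<Sum>i<4 ^ n. (cmod (op_coeff N Q Y i))\<^sup>2"
  obtain c where c: "Y = mat (2 ^ n) (2 ^ n) (\<lambda>(i, j). \<Sum>k<4 ^ n. c $ k * Q k $$ (i, j))"
    using Q Y(1) unfolding orthogonal_operator_basis_def by blast
  have "\<exists>k<4 ^ n. op_coeff N Q Y k \<noteq> 0"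
  proof (rule ccontr)
    assume "\<not> ?thesis"
    then have "c $ k = 0" if "k < 4 ^ n" for k using that op_coeff_expansion[OF Q that c] by auto
    then have "Y = 0\<^sub>m (2 ^ n) (2 ^ n)" by (subst c) (intro eq_matI, auto)
    then show False using Y by simp
  qed
  then obtain k where k: "k < 4 ^ n" "op_coeff N Q Y k \<noteq> 0" by blast
  then have s: "0 < ?s" by (intro sum_pos2[of _ k]) auto
  let ?r = "complex_of_real (sqrt ?s)"
  have r: "?r * ?r = complex_of_real ?s"
    using s by (simp only: of_real_mult[symmetric] real_sqrt_mult_self abs_of_pos)
  have "vectorization n N Q Y \<bullet>c vectorization n N Q Y
    = (\<Sum>k<4 ^ n. (op_coeff N Q Y k * cnj (op_coeff N Q Y k)) / (?r * ?r))"
    by (simp add: vectorization_def scalar_prod_def lessThan_atLeast0)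
  also have "\<dots> = (\<Sum>k<4 ^ n. complex_of_real ((cmod (op_coeff N Q Y k))\<^sup>2) / complex_of_real ?s)"
    unfolding r complex_norm_square ..
  also have "\<dots> = complex_of_real ?s / complex_of_real ?s"
    by (simp only: sum_divide_distrib[symmetric] of_real_sum)
  also have "\<dots> = 1"
    using s by (intro divide_self) (simp only: of_real_eq_0_iff)
  finally show ?thesis .
qed

lemma heisenberg_carrier:
  "U \<in> carrier_mat d d \<Longrightarrow> X \<in> carrier_mat d d \<Longrightarrow> heisenberg U X \<in> carrier_mat d d"
  unfolding heisenberg_def by (intro mult_carrier_mat[of _ d d]) auto

text \<open>Conjugation by a unitary can be undone: multiplying by \<open>U\<close> on the left and
  by its adjoint on the right recovers \<open>X\<close>.\<close>

lemma heisenberg_nonzero: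
  assumes U: "unitary_op d U" and X: "X \<in> carrier_mat d d" "X \<noteq> 0\<^sub>m d d"
  shows "heisenberg U X \<noteq> 0\<^sub>m d d"
proof
  assume 0: "heisenberg U X = 0\<^sub>m d d"
  have c: "U \<in> carrier_mat d d" "mat_adjoint U \<in> carrier_mat d d" and UU: "U * mat_adjoint U = 1\<^sub>m d"
    using U by (auto simp: unitary_op_def)
  have "heisenberg U X = mat_adjoint U * (X * U)"
    unfolding heisenberg_def by (rule assoc_mult_mat[OF c(2) X(1) c(1)])
  then have "U * heisenberg U X = (U * mat_adjoint U) * (X * U)"
    using assoc_mult_mat[OF c(1,2) mult_carrier_mat[OF X(1) c(1)]] by simp
  also have "\<dots> = X * U" unfolding UU by (rule left_mult_one_mat[OF mult_carrier_mat[OF X(1) c(1)]])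
  finally have "X * U = 0\<^sub>m d d" using c 0 by simp
  moreover have "X = X * U * mat_adjoint U"
    unfolding assoc_mult_mat[OF X(1) c] UU using X by simp
  ultimately have "X = 0\<^sub>m d d" using c by (metis left_mult_zero_mat)
  then show False using X by simp
qed

section \<open>The estimator\<close>

text \<open>The parity of \<open>c\<close> selects an eigenspace of the partial swap: even for
  eigenvalue 1, odd for eigenvalue -1.\<close>

definition swap_effect :: "nat \<Rightarrow> nat set \<Rightarrow> nat set \<Rightarrow> nat \<Rightarrow> complex mat" where
  "swap_effect n A B c = (1 / 2) \<cdot>\<^sub>m (1\<^sub>m (4 ^ n * 4 ^ n) +
     complex_of_real ((- 1) ^ c) \<cdot>\<^sub>m partial_swap (4 ^ n) (sub_index n A) (sub_index n B))"

text \<open>The measurement and its post-processing are fixed by \<open>n\<close>, \<open>A\<close>,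
  \<open>B\<close> and \<open>M\<close>. The operator and its basis enter only through the state, so
  one algorithm serves them all.\<close>

lemma swap_test_success:
  fixes M :: nat and \<epsilon> :: real
  assumes bip: "bipartition n A B"
    and M: "0 < M" and e: "0 < \<epsilon>" "\<epsilon> \<le> 1"
  shows "povm ((4 ^ n) ^ (2 * M)) (2 ^ M) (product_effect (swap_effect n A B) M)"
    and "\<And>N Q Y. vectorization n N Q Y \<bullet>c vectorization n N Q Y = 1 \<Longrightarrow>
      success_prob (2 ^ M) (product_effect (swap_effect n A B) M) (\<lambda>j. 1 - score M j / M)
        (copies (2 * M) (vectorization n N Q Y)) (lin_op_entanglement n A B N Q Y) \<epsilon>
      \<ge> 1 - 2 * exp (- (M * \<epsilon>\<^sup>2 / 4))"
proof -
  let ?D = "4 ^ n :: nat" and ?S = "partial_swap (4 ^ n) (sub_index n A) (sub_index n B)"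
    and ?P = "swap_effect n A B"
  have SS: "?S * ?S = 1\<^sub>m (?D * ?D)"
    by (rule partial_swap_involution[OF bipartition_inj[OF bip] bipartition_glue[OF bip]])
  have proj: "projector (?D * ?D) (?P c)" for c
    unfolding swap_effect_def
    by (rule projector_of_involution[OF hermitian_partial_swap SS]) (simp add: power_mult[symmetric])
  have P01: "?P 0 + ?P 1 = 1\<^sub>m (?D * ?D)"
    using carrier_matD[OF partial_swap_carrier[of ?D "sub_index n A" "sub_index n B"]]
    unfolding swap_effect_def by (intro eq_matI) (auto simp: field_simps)
  have "povm ((?D * ?D) ^ M) (2 ^ M) (product_effect ?P M)"
    by (rule povm_product_effect[OF proj P01])
  then show "povm ((4 ^ n) ^ (2 * M)) (2 ^ M) (product_effect (swap_effect n A B) M)"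
    by (simp only: power_mult power2_eq_square)
  fix N Q Y
  let ?v = "vectorization n N Q Y"
  assume unit: "?v \<bullet>c ?v = 1"
  let ?u = "tensor_vec ?v ?v" and ?\<rho> = "reduced_density n A B N Q Y"
  define p where "p = Re (mat_trace (?\<rho> * ?\<rho>))"
  define q where "q c = Re ((?P c *\<^sub>v ?u) \<bullet>c ?u)" for c
  have v: "?v \<in> carrier_vec ?D" by simp
  have u: "?u \<in> carrier_vec (?D * ?D)" using v by simp
  have uu: "?u \<bullet>c ?u = 1" by (simp add: tensor_vec_inner[OF v v v v] unit)
  have tr: "mat_trace (?\<rho> * ?\<rho>) = (?S *\<^sub>v ?u) \<bullet>c ?u"
    unfolding reduced_density_def by (rule purity_eq_partial_swap[OF bip v])
  have pos: "0 \<le> (?P c *\<^sub>v ?u) \<bullet>c ?u" for c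
    using projector_psd[OF proj] u by (simp add: psd_op_def)
  \<comment> \<open>In the order on complex numbers, nonnegativity includes being real, so nothing
    is lost by taking real parts in \<open>q\<close>.\<close>
  then have qP: "(?P c *\<^sub>v ?u) \<bullet>c ?u = complex_of_real (q c)" and q0: "0 \<le> q c" for c
    by (auto simp: q_def less_eq_complex_def complex_eq_iff)
  have q: "q c = (1 + (- 1) ^ c * p) / 2" for c
    unfolding q_def swap_effect_def involution_projector_inner[OF partial_swap_carrier u] uu tr[symmetric]
    by (simp add: p_def)
  \<comment> \<open>The purity \<open>p\<close> is thus the mean of the outcome that scores 1 with
    probability \<open>q 0\<close> and -1 with probability \<open>q 1\<close>.\<close>
  have q01: "q 0 + q 1 = 1" "p = q 0 - q 1" by (simp_all add: q field_simps)
  let ?w = "seq_weight q M" and ?f = "\<lambda>j. 1 - score M j / M"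
  have t: "lin_op_entanglement n A B N Q Y = 1 - p"
    by (simp add: lin_op_entanglement_def p_def)
  \<comment> \<open>Success is the exact complement of the tail event, so its probability is the
    total weight 1 minus the tail.\<close>
  have good: "\<bar>?f j - (1 - p)\<bar> \<le> \<epsilon> \<longleftrightarrow> \<not> M * \<epsilon> < \<bar>score M j - M * p\<bar>" for j
  proof -
    have "?f j - (1 - p) = - (score M j - M * p) / M" using M by (simp add: field_simps)
    then have "\<bar>?f j - (1 - p)\<bar> = \<bar>score M j - M * p\<bar> / M"
      by (simp only: abs_divide abs_minus_cancel abs_of_nat)
    then show ?thesis using M by (simp add: field_simps not_less)
  qed
  have "success_prob (2 ^ M) (product_effect ?P M) ?f (copies (2 * M) ?v) (1 - p) \<epsilon>
    = (\<Sum>j | j < 2 ^ M \<and> \<not> M * \<epsilon> < \<bar>score M j - M * p\<bar>. ?w j)"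
    unfolding success_prob_def outcome_prob_def good
    by (simp add: product_effect_expectation[OF proj v qP])
  also have "\<dots> = (\<Sum>j<2 ^ M. ?w j) - (\<Sum>j | j < 2 ^ M \<and> M * \<epsilon> < \<bar>score M j - M * p\<bar>. ?w j)"
  proof -
    have "(\<Sum>j<2 ^ M. ?w j) = (\<Sum>j \<in> {j. j < 2 ^ M \<and> \<not> M * \<epsilon> < \<bar>score M j - M * p\<bar>} \<union>
        {j. j < 2 ^ M \<and> M * \<epsilon> < \<bar>score M j - M * p\<bar>}. ?w j)"
      by (intro sum.cong) auto
    also have "\<dots> = (\<Sum>j | j < 2 ^ M \<and> \<not> M * \<epsilon> < \<bar>score M j - M * p\<bar>. ?w j) +
        (\<Sum>j | j < 2 ^ M \<and> M * \<epsilon> < \<bar>score M j - M * p\<bar>. ?w j)"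
      by (intro sum.union_disjoint) auto
    finally show ?thesis by simp
  qed
  also have "\<dots> \<ge> 1 - 2 * exp (- (M * \<epsilon>\<^sup>2 / 4))"
    using seq_weight_tail[OF q0 q0 q01 e, of M] sum_seq_weight[of q M] q01 by simp
  finally show "success_prob (2 ^ M) (product_effect (swap_effect n A B) M) ?f
      (copies (2 * M) ?v) (lin_op_entanglement n A B N Q Y) \<epsilon> \<ge> 1 - 2 * exp (- (M * \<epsilon>\<^sup>2 / 4))"
    unfolding t .
qed

text \<open>The failure bound is at most \<open>\<delta>\<close> as soon as \<open>M\<close> reaches
  \<open>x\<close>, so \<open>M\<close> is \<open>x\<close> rounded up. As \<open>\<delta>\<close>
  is at most 1/2, \<open>L\<close> is at least \<open>ln 2\<close>, so \<open>x\<close> is at most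
  \<open>8 * L / \<epsilon>^2\<close>. Rounding costs at most 1, hence at most
  \<open>2 * L / \<epsilon>^2\<close>. Two copies per pair turn 10 into 20.\<close>

lemma sample_size:
  fixes \<epsilon> \<delta> :: real
  assumes e: "0 < \<epsilon>" "\<epsilon> < 1" and d: "0 < \<delta>" "\<delta> \<le> 1 / 2"
  obtains M :: nat where "0 < M" "real (2 * M) \<le> 20 * ln (1 / \<delta>) / \<epsilon>\<^sup>2" "2 * exp (- (M * \<epsilon>\<^sup>2 / 4)) \<le> \<delta>"
proof
  define L where "L = ln (1 / \<delta>)"
  define x where "x = 4 * ln (2 / \<delta>) / \<epsilon>\<^sup>2"
  define M where "M = nat \<lceil>x\<rceil>"
  have L2: "ln 2 \<le> L" unfolding L_def using d by (subst ln_le_cancel_iff) (auto simp: field_simps)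
  have "exp (1 / 2) \<le> (2::real)" using exp_bound[of "1 / 2"] by (simp add: power2_eq_square)
  then have ln2: "1 / 2 \<le> ln (2::real)" by (subst ln_ge_iff) auto
  have split: "ln (2 / \<delta>) = ln 2 + L"
    using d by (simp add: L_def ln_div)
  have x0: "0 < x" using e L2 ln2 unfolding x_def split by (intro divide_pos_pos) auto
  show "0 < M" using x0 by (simp add: M_def)
  have e2: "0 < \<epsilon>\<^sup>2" "\<epsilon>\<^sup>2 \<le> 1" using e by (auto simp: power_le_one)
  have Mx: "x \<le> M" "M \<le> x + 1" using x0 by (auto simp: M_def)
  have "1 \<le> 2 * L / \<epsilon>\<^sup>2" using e2 L2 ln2 by (simp add: field_simps)
  moreover have "x \<le> 8 * L / \<epsilon>\<^sup>2" unfolding x_def split using L2 e2 by (intro divide_right_mono) auto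
  ultimately have "real M \<le> 10 * L / \<epsilon>\<^sup>2" using Mx(2) by (simp add: add_divide_distrib[symmetric])
  then show "real (2 * M) \<le> 20 * ln (1 / \<delta>) / \<epsilon>\<^sup>2" by (simp add: L_def)
  have "ln (2 / \<delta>) = x * \<epsilon>\<^sup>2 / 4" using e by (simp add: x_def)
  also have "\<dots> \<le> M * \<epsilon>\<^sup>2 / 4" using Mx(1) e2 by (intro divide_right_mono mult_right_mono) auto
  finally have "exp (- (M * \<epsilon>\<^sup>2 / 4)) \<le> exp (- ln (2 / \<delta>))" by simp
  also have "\<dots> = \<delta> / 2" using d by (simp add: exp_minus)
  finally show "2 * exp (- (M * \<epsilon>\<^sup>2 / 4)) \<le> \<delta>" by simp
qed

theorem theorem2:
  shows "\<exists>C0::real. C0 > 0 \<and>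
    (\<forall>(n::nat) (A::nat set) (B::nat set) (N::real) (Q::nat \<Rightarrow> complex mat) (\<epsilon>::real) (\<delta>::real).
       n \<ge> 1 \<longrightarrow> bipartition n A B \<longrightarrow> orthogonal_operator_basis n N Q \<longrightarrow>
       0 < \<epsilon> \<longrightarrow> \<epsilon> < 1 \<longrightarrow> 0 < \<delta> \<longrightarrow> \<delta> \<le> 1 / 2 \<longrightarrow>
       (\<exists>(m::nat) (K::nat) (E::nat \<Rightarrow> complex mat) (f::nat \<Rightarrow> real).
          real m \<le> C0 * ln (1 / \<delta>) / \<epsilon>\<^sup>2 \<and>
          povm ((4 ^ n) ^ m) K E \<and>
          (\<forall>(X::complex mat) (U::complex mat).
             hermitian_op (2 ^ n) X \<longrightarrow> mat_trace (X * X) = 2 ^ n \<longrightarrow> unitary_op (2 ^ n) U \<longrightarrow>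
             success_prob K E f (copies m (vectorization n N Q (heisenberg U X)))
               (lin_op_entanglement n A B N Q (heisenberg U X)) \<epsilon> \<ge> 1 - \<delta>)))"
proof (intro exI[of _ "20 :: real"] conjI allI impI)
  fix n :: nat and A B :: "nat set" and N :: real and Q :: "nat \<Rightarrow> complex mat" and \<epsilon> \<delta> :: real
  assume bip: "bipartition n A B" and Q: "orthogonal_operator_basis n N Q"
    and e: "0 < \<epsilon>" "\<epsilon> < 1" and d: "0 < \<delta>" "\<delta> \<le> 1 / 2"
  obtain M :: nat where M: "0 < M" "real (2 * M) \<le> 20 * ln (1 / \<delta>) / \<epsilon>\<^sup>2" "2 * exp (- (M * \<epsilon>\<^sup>2 / 4)) \<le> \<delta>"
    using sample_size[OF e d] .
  note test = swap_test_success[OF bip M(1) e(1) less_imp_le[OF e(2)]]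
  have unit: "vectorization n N Q (heisenberg U X) \<bullet>c vectorization n N Q (heisenberg U X) = 1"
    if "hermitian_op (2 ^ n) X" "mat_trace (X * X) = 2 ^ n" "unitary_op (2 ^ n) U" for X U
  proof (rule vectorization_unit[OF Q])
    have c: "X \<in> carrier_mat (2 ^ n) (2 ^ n)" "U \<in> carrier_mat (2 ^ n) (2 ^ n)"
      using that by (auto simp: hermitian_op_def unitary_op_def)
    then show "heisenberg U X \<in> carrier_mat (2 ^ n) (2 ^ n)" by (intro heisenberg_carrier)
    \<comment> \<open>For the zero operator the trace would be 0 instead of
      \<open>2 ^ n\<close>.\<close>
    have "X \<noteq> 0\<^sub>m (2 ^ n) (2 ^ n)" using that(2) by (auto simp: mat_trace_def)
    then show "heisenberg U X \<noteq> 0\<^sub>m (2 ^ n) (2 ^ n)" using c that(3) by (intro heisenberg_nonzero)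
  qed
  let ?E = "product_effect (swap_effect n A B) M" and ?f = "\<lambda>j. 1 - score M j / M"
  have "\<forall>X U. hermitian_op (2 ^ n) X \<longrightarrow> mat_trace (X * X) = 2 ^ n \<longrightarrow> unitary_op (2 ^ n) U \<longrightarrow>
      success_prob (2 ^ M) ?E ?f (copies (2 * M) (vectorization n N Q (heisenberg U X)))
        (lin_op_entanglement n A B N Q (heisenberg U X)) \<epsilon> \<ge> 1 - \<delta>"
    using order.trans[OF diff_left_mono[OF M(3)] test(2)[OF unit]] by blast
  with M(2) test(1) show "\<exists>(m::nat) (K::nat) (E::nat \<Rightarrow> complex mat) (f::nat \<Rightarrow> real).
          real m \<le> 20 * ln (1 / \<delta>) / \<epsilon>\<^sup>2 \<and>
          povm ((4 ^ n) ^ m) K E \<and>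
          (\<forall>(X::complex mat) (U::complex mat).
             hermitian_op (2 ^ n) X \<longrightarrow> mat_trace (X * X) = 2 ^ n \<longrightarrow> unitary_op (2 ^ n) U \<longrightarrow>
             success_prob K E f (copies m (vectorization n N Q (heisenberg U X)))
               (lin_op_entanglement n A B N Q (heisenberg U X)) \<epsilon> \<ge> 1 - \<delta>)"
    by blast
qed simp

end
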